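(* Let $K$ be a number field with ring of integers $\mathcal{O}_K$, and let $\phi(x) = x^d + a_{d-1} x^{d-1} + \dotsb + a_0\in \mathcal{O}_K[x]$ with $d\ge 2$. Assume that $0$ is preperiodic under $\phi$, and that for every archimedean place $\nu$ of $K$ the Julia set of $\phi$ (as a complex polynomial via the embedding corresponding to $\nu$) does not intersect the open unit disk $\{z\in\mathbb{C}:|z|<1\}$. Then $\phi(x)=x^d$.
   Context: A point $z$ is preperiodic under $\phi$ if $\phi^n(z)=\phi^m(z)$ for some $n>m\ge0$. The Julia set is the complement of the set where the iterates $\{\phi^n\}$ form an equicontinuous family (equivalently, the support of the canonical invariant measure). *)

theory Defs
  imports "HOL-Complex_Analysis.Complex_Analysis" "HOL-Computational_Algebra.Computational_Algebra"
begin

definition preperiodic :: "('a \<Rightarrow> 'a) \<Rightarrow> 'a \<Rightarrow> bool" where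
  "preperiodic f z \<longleftrightarrow> (\<exists>n m. n > m \<and> (f ^^ n) z = (f ^^ m) z)"


text \<open>
  A number field is a type of class \<^class>\<open>field_char_0\<close> that is finitely generated as a vector
  space over the rationals. Its ring of integers is the set of its elements satisfying
  \<^const>\<open>algebraic_int\<close>.
\<close>

definition number_field :: "'k :: field_char_0 itself \<Rightarrow> bool" where
  "number_field _ \<longleftrightarrow>
     (\<exists>B :: 'k set. finite B \<and> module.span (\<lambda>(q :: rat) x. of_rat q * x) B = UNIV)"

lemma vector_space_of_rat: "vector_space (\<lambda>(q :: rat) (x :: 'k :: field_char_0). of_rat q * x)"
  by unfold_locales (simp_all add: algebra_simps of_rat_add of_rat_mult)

definition ring_of_integers :: "'k :: field_char_0 set" where
  "ring_of_integers = {x. algebraic_int x}"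

definition field_embedding :: "('a :: field \<Rightarrow> 'b :: field) \<Rightarrow> bool" where
  "field_embedding \<sigma> \<longleftrightarrow> \<sigma> 1 = 1 \<and>
     (\<forall>x y. \<sigma> (x + y) = \<sigma> x + \<sigma> y) \<and> (\<forall>x y. \<sigma> (x * y) = \<sigma> x * \<sigma> y)"

definition absolute_value :: "('k :: field \<Rightarrow> real) \<Rightarrow> bool" where
  "absolute_value v \<longleftrightarrow> (\<forall>x. v x \<ge> 0) \<and> (\<forall>x. v x = 0 \<longleftrightarrow> x = 0) \<and>
     (\<forall>x y. v (x * y) = v x * v y) \<and> (\<forall>x y. v (x + y) \<le> v x + v y)"

definition archimedean :: "('k :: field \<Rightarrow> real) \<Rightarrow> bool" where
  "archimedean v \<longleftrightarrow> absolute_value v \<and> \<not> (\<forall>x y. v (x + y) \<le> max (v x) (v y))"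

definition abs_equiv :: "(('k :: field \<Rightarrow> real) \<times> ('k \<Rightarrow> real)) set" where
  "abs_equiv = {(v, w). archimedean v \<and> archimedean w \<and> (\<exists>s>0. \<forall>x. w x = v x powr s)}"

definition archimedean_places :: "('k :: field \<Rightarrow> real) set set" where
  "archimedean_places = {v. archimedean v} // abs_equiv"

text \<open>
  The embedding corresponding to a place is only determined up to complex conjugation.
\<close>

definition embedding_at :: "('k :: field \<Rightarrow> real) set \<Rightarrow> ('k \<Rightarrow> complex) \<Rightarrow> bool" where
  "embedding_at \<nu> \<sigma> \<longleftrightarrow> field_embedding \<sigma> \<and> (\<lambda>x. cmod (\<sigma> x)) \<in> \<nu>"

lemma equiv_abs_equiv: "equiv {v :: 'k :: field \<Rightarrow> real. archimedean v} abs_equiv"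
proof (rule equivI)
  show "abs_equiv \<subseteq> {v :: 'k \<Rightarrow> real. archimedean v} \<times> {v. archimedean v}"
    by (auto simp: abs_equiv_def)
  show "refl_on {v :: 'k \<Rightarrow> real. archimedean v} abs_equiv"
    by (rule refl_onI)
      (auto simp: abs_equiv_def archimedean_def absolute_value_def intro!: exI[of _ 1])
  show "sym (abs_equiv :: (('k \<Rightarrow> real) \<times> _) set)"
  proof (rule symI)
    fix v w :: "'k \<Rightarrow> real" assume "(v, w) \<in> abs_equiv"
    then obtain s where s: "s > 0" "\<forall>x. w x = v x powr s" and vw: "archimedean v" "archimedean w"
      by (auto simp: abs_equiv_def)
    have "v x = w x powr (1 / s)" for x
      using s vw(1) by (simp add: powr_powr archimedean_def absolute_value_def)
    then show "(w, v) \<in> abs_equiv"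
      using s vw by (auto simp: abs_equiv_def intro!: exI[of _ "1 / s"])
  qed
  show "trans (abs_equiv :: (('k \<Rightarrow> real) \<times> _) set)"
    by (rule transI) (auto simp: abs_equiv_def powr_powr, metis mult_pos_pos)
qed

lemma field_embedding_archimedean:
  fixes \<sigma> :: "'k :: field_char_0 \<Rightarrow> complex"
  assumes "field_embedding \<sigma>"
  shows "archimedean (\<lambda>x. cmod (\<sigma> x))"
proof -
  have add: "\<sigma> (x + y) = \<sigma> x + \<sigma> y" and mult: "\<sigma> (x * y) = \<sigma> x * \<sigma> y" and one: "\<sigma> 1 = 1" for x y
    using assms by (auto simp: field_embedding_def)
  have zero: "\<sigma> 0 = 0"
    using add[of 0 0] by simp
  have "x = 0" if "\<sigma> x = 0" for x
    using mult[of x "inverse x"] that one by (cases "x = 0") auto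
  then have "absolute_value (\<lambda>x. cmod (\<sigma> x))"
    by (auto simp: absolute_value_def add mult zero norm_mult norm_triangle_ineq)
  moreover have "cmod (\<sigma> (1 + 1)) > max (cmod (\<sigma> 1)) (cmod (\<sigma> 1))"
    by (simp only: add one) simp
  ultimately show ?thesis
    unfolding archimedean_def by (metis not_le)
qed

lemma ex_archimedean_place:
  fixes \<sigma> :: "'k :: field_char_0 \<Rightarrow> complex"
  assumes "field_embedding \<sigma>"
  shows "\<exists>\<nu>\<in>archimedean_places. embedding_at \<nu> \<sigma>"
  using field_embedding_archimedean[OF assms] equiv_class_self[OF equiv_abs_equiv] assms
  unfolding archimedean_places_def embedding_at_def by (meson mem_Collect_eq quotientI)


text \<open>
  The iterates are regarded as maps into the Riemann sphere, so equicontinuity refers to the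
  chordal metric (with the Euclidean metric, points escaping to infinity would be excluded from
  the Fatou set). On the source the two metrics induce the same topology on the complex plane.
  The point at infinity lies in the Fatou set of every polynomial of degree at least 2, so for
  these the Julia set is a subset of the plane.
\<close>

definition chordal_dist :: "complex \<Rightarrow> complex \<Rightarrow> real" where
  "chordal_dist z w = 2 * cmod (z - w) / (sqrt (1 + (cmod z)\<^sup>2) * sqrt (1 + (cmod w)\<^sup>2))"

definition equicontinuous_at :: "complex \<Rightarrow> (complex \<Rightarrow> complex) set \<Rightarrow> bool" where
  "equicontinuous_at z F \<longleftrightarrow>
     (\<forall>\<epsilon>>0. \<exists>\<delta>>0. \<forall>f\<in>F. \<forall>w. dist w z < \<delta> \<longrightarrow> chordal_dist (f w) (f z) < \<epsilon>)"

definition fatou_set :: "(complex \<Rightarrow> complex) \<Rightarrow> complex set" where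
  "fatou_set f = \<Union>{U. open U \<and> (\<forall>z\<in>U. equicontinuous_at z (range (\<lambda>n. f ^^ n)))}"

definition julia_set :: "(complex \<Rightarrow> complex) \<Rightarrow> complex set" where
  "julia_set f = - fatou_set f"

end

theory Submission
  imports Defs
begin

text \<open>
  Some embedding of the number field into the complex numbers exists; one is enough. Let \<open>f\<close> be
  the image of the polynomial under it. As \<open>0\<close> has a bounded orbit and the unit disc is a connected
  part of the Fatou set, the whole disc lies in the filled Julia set, so all iterates of \<open>f\<close> are
  bounded by one constant \<open>R\<close> on the disc. By Cauchy's inequality all coefficients of all iterates
  are at most \<open>R\<close> in modulus. If \<open>f = z\<^sup>d + a z\<^sup>j + \<dots>\<close> with \<open>a \<noteq> 0\<close> the first coefficient below the
  leading one, then the corresponding coefficient of the \<open>n\<close>-th iterate is \<open>d\<^bsup>n-1\<^esup> a\<close>, which is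
  unbounded.

  The embedding comes from the finite-dimensional complex space of rational-linear maps from the
  field to the complex numbers: multiplications by field elements act on it as commuting operators,
  and the eigenvalues on a common eigenvector define a ring homomorphism.
\<close>

section \<open>Complex embeddings of number fields\<close>

definition rat_linear :: "('k :: field_char_0 \<Rightarrow> complex) \<Rightarrow> bool" where
  "rat_linear \<eta> \<longleftrightarrow> (\<forall>x y. \<eta> (x + y) = \<eta> x + \<eta> y) \<and> (\<forall>q x. \<eta> (of_rat q * x) = of_rat q * \<eta> x)"

text \<open>Infinitely many distinct powers of \<open>b\<close> outnumber the finite spanning set,
  hence are dependent. Dependence concerns sets, so coinciding powers are treated apart, with
  \<open>x^j - x^i\<close>.\<close>

lemma number_field_algebraic:
  fixes b :: "'k :: field_char_0"
  assumes "number_field TYPE('k)"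
  shows "\<exists>p :: rat poly. p \<noteq> 0 \<and> (\<Sum>i\<le>degree p. of_rat (coeff p i) * b ^ i) = 0"
proof -
  interpret V: vector_space "\<lambda>(q :: rat) (x :: 'k). of_rat q * x"
    by (rule vector_space_of_rat)
  obtain B :: "'k set" where B: "finite B" "V.span B = UNIV"
    using assms by (auto simp: number_field_def)
  show ?thesis
  proof (cases "inj (\<lambda>i::nat. b ^ i)")
    case True
    define S where "S = range (\<lambda>i::nat. b ^ i)"
    have "infinite S"
      unfolding S_def using True range_inj_infinite by blast
    then have "V.dependent S"
      using V.independent_span_bound[OF B(1), of S] B(2) by auto
    then obtain t u v where t: "finite t" "t \<subseteq> S" "(\<Sum>v\<in>t. of_rat (u v) * v) = 0" "v \<in> t" "u v \<noteq> 0"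
      unfolding V.dependent_explicit by blast
    obtain I where I: "t = (\<lambda>i. b ^ i) ` I" "finite I"
      using t(1,2) unfolding S_def by (meson finite_subset_image)
    define p where "p = (\<Sum>i\<in>I. monom (u (b ^ i)) i)"
    have coeff: "coeff p i = (if i \<in> I then u (b ^ i) else 0)" for i
      using I(2) by (simp add: p_def coeff_sum if_distrib cong: if_cong)
    obtain i where i: "i \<in> I" "v = b ^ i"
      using t(4) I(1) by blast
    have "p \<noteq> 0"
      using coeff[of i] i t(5) by auto
    have "(\<Sum>i\<le>degree p. of_rat (coeff p i) * b ^ i) = (\<Sum>i\<in>I. of_rat (u (b ^ i)) * b ^ i)"
    proof (rule sum.mono_neutral_cong)
      show "finite I" "finite {..degree p}"
        by (use I in auto)
      show "of_rat (coeff p i) * b ^ i = 0" if "i \<in> {..degree p} - I" for i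
        using that by (simp add: coeff)
      show "of_rat (u (b ^ i)) * b ^ i = 0" if "i \<in> I - {..degree p}" for i
        using that coeff[of i] by (simp add: coeff_eq_0)
    qed (simp add: coeff)
    also have "\<dots> = (\<Sum>v\<in>t. of_rat (u v) * v)"
      unfolding I(1) using True by (subst sum.reindex) (auto simp: inj_on_def)
    finally show ?thesis
      using t(3) \<open>p \<noteq> 0\<close> by auto
  next
    case False
    then obtain i j where ij: "i < j" "b ^ i = b ^ j"
      unfolding inj_def by (metis linorder_neqE_nat)
    define p :: "rat poly" where "p = monom 1 j - monom 1 i"
    have deg: "degree p = j"
      using ij(1) unfolding p_def
      by (subst diff_conv_add_uminus, subst degree_add_eq_left) (auto simp: degree_monom_eq)
    have "(\<Sum>k\<le>degree p. of_rat (coeff p k) * b ^ k)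
      = (\<Sum>k\<le>j. (if k = j then b ^ k else 0) - (if k = i then b ^ k else 0))"
      unfolding deg by (intro sum.cong refl) (auto simp: p_def)
    also have "\<dots> = 0"
      using ij by (simp add: sum_subtractf)
    finally show ?thesis
      using deg ij(1) by (intro exI[of _ p]) auto
  qed
qed

lemma rat_linear_sum:
  assumes "rat_linear \<eta>" and "finite I"
  shows "\<eta> (\<Sum>i\<in>I. of_rat (q i) * x i) = (\<Sum>i\<in>I. of_rat (q i) * \<eta> (x i))"
proof -
  have "\<eta> 0 = 0"
    using assms(1) unfolding rat_linear_def by (metis add_cancel_right_right)
  with assms(2) show ?thesis
    by (induction rule: finite_induct) (use assms(1) in \<open>auto simp: rat_linear_def\<close>)
qed

text \<open>Multiplication by \<open>b\<close> acts on maps by precomposition, and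
  \<open>\<eta>\<close> is to be an eigenvector of this operator. The zero map is not excluded, so
  nonvanishing is carried along separately.\<close>

definition eigen_of :: "('k :: field_char_0 \<Rightarrow> complex) \<Rightarrow> 'k \<Rightarrow> bool" where
  "eigen_of \<eta> b \<longleftrightarrow> (\<exists>c. \<forall>x. \<eta> (b * x) = c * \<eta> x)"

text \<open>Let \<open>T\<close> be precomposition with multiplication by \<open>b\<close>, and
  split off a root: \<open>p = (X - r) q\<close>. Either \<open>(T - r) \<eta> = 0\<close> and
  \<open>\<eta>\<close> itself is the eigenvector, or \<open>(T - r) \<eta>\<close> is nonzero and
  killed by \<open>q(T)\<close>, of lower degree.\<close>

lemma eigenvector_of_annihilating_poly:
  fixes \<eta> :: "'k :: field_char_0 \<Rightarrow> complex"
  assumes "rat_linear \<eta>" and "\<eta> x0 \<noteq> 0" and "\<forall>a\<in>B. eigen_of \<eta> a"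
    and "p \<noteq> 0" and "\<forall>x. (\<Sum>i\<le>degree p. coeff p i * \<eta> (b ^ i * x)) = 0"
  shows "\<exists>\<mu> x1. rat_linear \<mu> \<and> \<mu> x1 \<noteq> 0 \<and> (\<forall>a\<in>insert b B. eigen_of \<mu> a)"
  using assms
proof (induction "degree p" arbitrary: p \<eta> x0)
  case 0
  then obtain c where c: "p = [:c:]"
    by (metis degree_eq_zeroE)
  with 0 show ?case
    by (auto dest: spec[of _ x0])
next
  case (Suc n)
  have "\<not> constant (poly p)"
    using Suc(2) by (simp add: constant_degree)
  then obtain r where "poly p r = 0"
    using fundamental_theorem_of_algebra by blast
  then obtain q where q: "p = [:-r, 1:] * q"
    unfolding poly_eq_0_iff_dvd by (auto elim: dvdE)
  have q0: "q \<noteq> 0"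
    using q Suc.prems(4) by auto
  have degq: "degree q = n"
    using Suc(2) q q0 degree_mult_eq[of "[:-r, 1:]" q] by simp
  define \<mu> where "\<mu> = (\<lambda>x. \<eta> (b * x) - r * \<eta> x)"
  show ?case
  proof (cases "\<forall>x. \<mu> x = 0")
    case True
    then have "eigen_of \<eta> b"
      by (auto simp: eigen_of_def \<mu>_def)
    then show ?thesis
      using Suc.prems by blast
  next
    case False
    then obtain x1 where x1: "\<mu> x1 \<noteq> 0"
      by blast
    have "\<eta> (b * (of_rat q * x)) = of_rat q * \<eta> (b * x)" for q x
      using Suc.prems(1) unfolding rat_linear_def by (metis mult.left_commute)
    then have lin: "rat_linear \<mu>"
      using Suc.prems(1) unfolding rat_linear_def \<mu>_def
      by (simp add: distrib_left right_diff_distrib mult.left_commute)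
    \<comment> \<open>Multiplications commute, so \<open>T - r\<close> preserves the eigenvalues at
      elements of \<open>B\<close>.\<close>
    have eig: "\<forall>a\<in>B. eigen_of \<mu> a"
    proof
      fix a assume "a \<in> B"
      then obtain c where c: "\<And>x. \<eta> (a * x) = c * \<eta> x"
        using Suc.prems(3) by (auto simp: eigen_of_def)
      have "\<mu> (a * x) = c * \<mu> x" for x
        using c[of "b * x"] by (simp add: \<mu>_def c mult.left_commute right_diff_distrib)
      then show "eigen_of \<mu> a"
        by (auto simp: eigen_of_def)
    qed
    have "(\<Sum>i\<le>degree q. coeff q i * \<mu> (b ^ i * x)) = 0" for x
    proof -
      have p: "coeff p i = coeff (pCons 0 q) i - r * coeff q i" for i
        by (simp add: q)
      have "0 = (\<Sum>i\<le>Suc n. coeff p i * \<eta> (b ^ i * x))"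
        using Suc.prems(5) Suc(2) by simp
      also have "\<dots> = (\<Sum>i\<le>Suc n. coeff (pCons 0 q) i * \<eta> (b ^ i * x)) - (\<Sum>i\<le>Suc n. r * coeff q i * \<eta> (b ^ i * x))"
        by (simp only: p left_diff_distrib sum_subtractf)
      also have "(\<Sum>i\<le>Suc n. coeff (pCons 0 q) i * \<eta> (b ^ i * x)) = (\<Sum>i\<le>n. coeff q i * \<eta> (b * (b ^ i * x)))"
        by (subst sum.atMost_Suc_shift) (simp add: mult.assoc)
      also have "(\<Sum>i\<le>Suc n. r * coeff q i * \<eta> (b ^ i * x)) = (\<Sum>i\<le>n. r * coeff q i * \<eta> (b ^ i * x))"
        using degq by (simp add: coeff_eq_0)
      finally show ?thesis
        by (simp add: degq \<mu>_def algebra_simps sum_subtractf)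
    qed
    then show ?thesis
      using Suc(1)[of q \<mu> x1] degq lin x1 eig q0 by auto
  qed
qed

lemma common_eigenvector:
  assumes K: "number_field TYPE('k :: field_char_0)" and "finite B"
  shows "\<exists>(\<eta> :: 'k \<Rightarrow> complex) x0. rat_linear \<eta> \<and> \<eta> x0 \<noteq> 0 \<and> (\<forall>b\<in>B. eigen_of \<eta> b)"
  using assms(2)
proof (induction rule: finite_induct)
  case empty
  interpret vector_space_pair "\<lambda>(q :: rat) (x :: 'k). of_rat q * x" "\<lambda>(q :: rat) (x :: complex). of_rat q * x"
    by (intro vector_space_pair.intro vector_space_of_rat)
  \<comment> \<open>The induction starts from any rational-linear extension of
    \<open>1 \<mapsto> 1\<close>.\<close>
  have "vs1.independent {1}"
    by simp
  then obtain g where g: "Vector_Spaces.linear (\<lambda>(q :: rat) (x :: 'k). of_rat q * x)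
      (\<lambda>(q :: rat) (x :: complex). of_rat q * x) g" "g 1 = 1"
    using linear_independent_extend[of "{1}" "\<lambda>_. 1"] by auto
  interpret g: Vector_Spaces.linear "\<lambda>(q :: rat) (x :: 'k). of_rat q * x"
    "\<lambda>(q :: rat) (x :: complex). of_rat q * x" g by (rule g)
  have "rat_linear g"
    unfolding rat_linear_def by (simp add: g.add g.scale)
  then show ?case
    using g(2) by (intro exI[of _ g] exI[of _ 1]) auto
next
  case (insert b B)
  then obtain \<eta> :: "'k \<Rightarrow> complex" and x0
    where \<eta>: "rat_linear \<eta>" "\<eta> x0 \<noteq> 0" "\<forall>b\<in>B. eigen_of \<eta> b" by blast
  obtain p :: "rat poly" where p: "p \<noteq> 0" "(\<Sum>i\<le>degree p. of_rat (coeff p i) * b ^ i) = 0"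
    using number_field_algebraic[OF K] by blast
  \<comment> \<open>By rational linearity of \<open>\<eta>\<close>, the relation
    \<open>p(b) = 0\<close> becomes an annihilating complex polynomial for the operator of
    \<open>b\<close>.\<close>
  define P :: "complex poly" where "P = map_poly of_rat p"
  have deg: "degree P = degree p" and cf: "coeff P i = of_rat (coeff p i)" for i
    unfolding P_def using p(1) by (simp_all add: degree_map_poly coeff_map_poly)
  have "P \<noteq> 0"
    using p(1) cf[of "degree p"] by auto
  moreover have "(\<Sum>i\<le>degree P. coeff P i * \<eta> (b ^ i * x)) = 0" for x
  proof -
    have "(\<Sum>i\<le>degree P. coeff P i * \<eta> (b ^ i * x)) = \<eta> (\<Sum>i\<le>degree p. of_rat (coeff p i) * (b ^ i * x))"
      by (simp add: rat_linear_sum[OF \<eta>(1)] deg cf)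
    also have "(\<Sum>i\<le>degree p. of_rat (coeff p i) * (b ^ i * x)) = (\<Sum>i\<le>degree p. of_rat (coeff p i) * b ^ i) * x"
      by (simp add: sum_distrib_right mult.assoc)
    also have "\<eta> \<dots> = 0"
      using rat_linear_sum[OF \<eta>(1), of "{}"] p(2) by simp
    finally show ?thesis .
  qed
  ultimately show ?case
    using eigenvector_of_annihilating_poly[OF \<eta>] by blast
qed

text \<open>By linearity, a common eigenvector for a finite spanning set is one for every field
  element. Comparing values at \<open>x0\<close>, where \<open>\<eta>\<close> does not vanish, shows
  that the eigenvalue \<open>\<tau> a\<close> is additive and multiplicative in
  \<open>a\<close>.\<close>

theorem number_field_embedding_exists:
  assumes K: "number_field TYPE('k :: field_char_0)"
  shows "\<exists>\<sigma> :: 'k \<Rightarrow> complex. field_embedding \<sigma>"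
proof -
  interpret V: vector_space "\<lambda>(q :: rat) (x :: 'k). of_rat q * x"
    by (rule vector_space_of_rat)
  obtain B :: "'k set" where B: "finite B" "V.span B = UNIV"
    using K by (auto simp: number_field_def)
  obtain \<eta> :: "'k \<Rightarrow> complex" and x0
    where \<eta>: "rat_linear \<eta>" "\<eta> x0 \<noteq> 0" "\<forall>b\<in>B. eigen_of \<eta> b"
    using common_eigenvector[OF K B(1)] by blast
  have "eigen_of \<eta> a" for a
  proof -
    obtain u where a: "a = (\<Sum>v\<in>B. of_rat (u v) * v)"
      using V.span_finite[OF B(1)] B(2) by auto
    obtain c where c: "\<And>b x. b \<in> B \<Longrightarrow> \<eta> (b * x) = c b * \<eta> x"
      using \<eta>(3) unfolding eigen_of_def by metis
    have "\<eta> (a * x) = (\<Sum>v\<in>B. of_rat (u v) * c v) * \<eta> x" for x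
      using rat_linear_sum[OF \<eta>(1) B(1), of u "\<lambda>v. v * x"] c
      by (simp add: a sum_distrib_right mult.assoc)
    then show ?thesis
      by (auto simp: eigen_of_def)
  qed
  then obtain \<tau> where \<tau>: "\<And>a x. \<eta> (a * x) = \<tau> a * \<eta> x"
    unfolding eigen_of_def by metis
  have "\<tau> (a + b) * \<eta> x0 = (\<tau> a + \<tau> b) * \<eta> x0" for a b
    using \<eta>(1) by (simp add: \<tau>[symmetric] rat_linear_def distrib_right)
  moreover have "\<tau> (a * b) * \<eta> x0 = (\<tau> a * \<tau> b) * \<eta> x0" for a b
    by (simp only: \<tau>[symmetric] mult.assoc)
  moreover have "\<tau> 1 * \<eta> x0 = 1 * \<eta> x0"
    by (simp only: \<tau>[symmetric] mult_1)
  ultimately show ?thesis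
    using \<eta>(2) by (auto simp: field_embedding_def)
qed

section \<open>Boundedness of the iterates on the unit disc\<close>

text \<open>Write \<open>f(z) = a + z g(z)\<close> with \<open>g\<close> nonconstant. Far out
  \<open>|g(z)| \<ge> 3\<close> and \<open>|a| \<le> |z|\<close>, which leaves the factor 2.\<close>

lemma poly_escape_radius:
  fixes f :: "complex poly"
  assumes "degree f \<ge> 2"
  shows "\<exists>R\<ge>1. \<forall>z. cmod z \<ge> R \<longrightarrow> cmod (poly f z) \<ge> 2 * cmod z"
proof -
  obtain a b p where f: "f = pCons a (pCons b p)"
    by (metis pCons_cases)
  with assms have "p \<noteq> 0"
    by (auto split: if_splits)
  then obtain r where r: "\<And>z. r \<le> cmod z \<Longrightarrow> 3 \<le> cmod (poly (pCons b p) z)"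
    using poly_infinity by blast
  have "cmod (poly f z) \<ge> 2 * cmod z" if z: "cmod z \<ge> max 1 (max r (cmod a))" for z
  proof -
    have "3 * cmod z \<le> cmod (poly (pCons b p) z) * cmod z"
      using r z by (intro mult_right_mono) auto
    also have "\<dots> = cmod (z * poly (pCons b p) z)"
      by (simp add: norm_mult)
    also have "\<dots> \<le> cmod (poly f z) + cmod a"
      using norm_triangle_ineq4[of "poly f z" a] by (simp add: f)
    finally show ?thesis
      using z by linarith
  qed
  then show ?thesis
    by (intro exI[of _ "max 1 (max r (cmod a))"]) auto
qed

text \<open>Once an orbit leaves the disc of radius \<open>R\<close>, its modulus at least doubles
  at every step. Thus any bound \<open>M\<close>, however large, improves to
  \<open>R\<close>.\<close>

lemma bounded_orbit_in_disc:
  assumes R: "R \<ge> (1::real)" "\<And>z. cmod z \<ge> R \<Longrightarrow> cmod (f z) \<ge> 2 * cmod z"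
    and M: "\<And>n. cmod ((f ^^ n) z) \<le> M"
  shows "cmod ((f ^^ n) z) \<le> R"
proof (rule ccontr)
  assume "\<not> cmod ((f ^^ n) z) \<le> R"
  then have gt: "cmod ((f ^^ n) z) > R"
    by simp
  have grow: "cmod ((f ^^ (k + n)) z) \<ge> 2 ^ k * R" for k
  proof (induction k)
    case (Suc k)
    have "1 * R \<le> 2 ^ k * R"
      using R(1) by (intro mult_right_mono) auto
    then have "cmod ((f ^^ (k + n)) z) \<ge> R"
      using Suc by linarith
    from R(2)[OF this] show ?case
      using Suc by simp
  qed (use gt in simp)
  obtain k where "M < 2 ^ k"
    using real_arch_pow[of 2 M] by auto
  also have "(2::real) ^ k \<le> 2 ^ k * R"
    using R(1) by simp
  finally show False
    using grow[of k] M[of "k + n"] by linarith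
qed

text \<open>Since \<open>sqrt (1 + x\<^sup>2) \<le> 1 + x\<close>, the threshold
  \<open>1 / (1 + R)\<close> cancels the factor coming from \<open>v\<close> and leaves
  \<open>2 |u - v| < 1 + |u|\<close>. This turns equicontinuity on the sphere into a Euclidean
  bound.\<close>

lemma chordal_dist_bound:
  assumes "R \<ge> 0" and "cmod v \<le> R" and "chordal_dist u v < 1 / (1 + R)"
  shows "cmod u < 1 + 2 * R"
proof -
  have s: "sqrt (1 + x\<^sup>2) \<le> 1 + x" if "x \<ge> 0" for x :: real
    using that by (intro real_le_lsqrt) (auto simp: power2_eq_square algebra_simps)
  have pos: "sqrt (1 + (cmod u)\<^sup>2) * sqrt (1 + (cmod v)\<^sup>2) > 0"
    by (intro mult_pos_pos) (auto simp: add_pos_nonneg)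
  have "2 * cmod (u - v) < 1 / (1 + R) * (sqrt (1 + (cmod u)\<^sup>2) * sqrt (1 + (cmod v)\<^sup>2))"
    using assms(3) pos unfolding chordal_dist_def by (simp only: pos_divide_less_eq)
  also have "\<dots> \<le> 1 / (1 + R) * ((1 + cmod u) * (1 + R))"
    using s[of "cmod u"] s[of "cmod v"] assms by (intro mult_left_mono mult_mono) auto
  also have "\<dots> = 1 + cmod u"
    using assms(1) by simp
  finally show ?thesis
    using norm_triangle_ineq2[of u v] assms(2) by linarith
qed

lemma preperiodic_orbit_finite:
  assumes "preperiodic f z"
  shows "finite (range (\<lambda>n. (f ^^ n) z))"
proof -
  obtain n m where nm: "n > m" "(f ^^ n) z = (f ^^ m) z"
    using assms by (auto simp: preperiodic_def)
  have "(f ^^ k) z \<in> (\<lambda>i. (f ^^ i) z) ` {..<n}" for k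
  proof (induction k rule: less_induct)
    case (less k)
    show ?case
    proof (cases "k < n")
      case False
      then have "(f ^^ k) z = (f ^^ (k - n)) ((f ^^ n) z)"
        by (metis comp_apply funpow_add le_add_diff_inverse2 not_less)
      also have "\<dots> = (f ^^ (k - n + m)) z"
        by (simp add: nm(2) funpow_add)
      finally show ?thesis
        using less[of "k - n + m"] nm(1) False by simp
    qed auto
  qed
  then show ?thesis
    by (meson finite_imageI finite_lessThan finite_subset image_subsetI)
qed

lemma iterates_bounded_on_unit_disc:
  fixes f :: "complex poly"
  assumes deg: "degree f \<ge> 2" and pre: "preperiodic (poly f) 0"
    and J: "julia_set (poly f) \<inter> {z. cmod z < 1} = {}"
  shows "\<exists>R. \<forall>n z. cmod z < 1 \<longrightarrow> cmod ((poly f ^^ n) z) \<le> R"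
proof -
  obtain R where R: "R \<ge> 1" "\<And>z. cmod z \<ge> R \<Longrightarrow> cmod (poly f z) \<ge> 2 * cmod z"
    using poly_escape_radius[OF deg] by blast
  \<comment> \<open>The filled Julia set: the escape radius serves all bounded orbits at once, which
    makes \<open>A\<close> closed.\<close>
  define A where "A = {z. \<forall>n. cmod ((poly f ^^ n) z) \<le> R}"
  have cont: "continuous_on UNIV (poly f ^^ n)" for n
    by (induction n) (auto intro!: continuous_intros simp: comp_def)
  have "closed A"
    unfolding A_def Collect_all_eq
    by (intro closed_INT ballI closed_Collect_le continuous_intros cont)
  then have clo: "closedin (top_of_set (ball 0 1)) (ball 0 1 \<inter> A)"
    by (rule closedin_closed_Int)
  \<comment> \<open>Near \<open>z\<close>, equicontinuity bounds all orbits by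
    \<open>1 + 2 * R\<close>, and the escape argument lowers this to \<open>R\<close>. So
    \<open>A\<close> is relatively clopen in the connected disc.\<close>
  have "\<exists>\<delta>>0. ball z \<delta> \<subseteq> A" if z: "z \<in> ball 0 1 \<inter> A" for z
  proof -
    have "z \<in> fatou_set (poly f)"
      using J z unfolding julia_set_def by auto
    then have "equicontinuous_at z (range (\<lambda>n. poly f ^^ n))"
      unfolding fatou_set_def by blast
    then obtain \<delta> where \<delta>: "\<delta> > 0"
      "\<And>n w. dist w z < \<delta> \<Longrightarrow> chordal_dist ((poly f ^^ n) w) ((poly f ^^ n) z) < 1 / (1 + R)"
      unfolding equicontinuous_at_def using R(1)
      by (auto dest!: spec[of _ "1 / (1 + R)"])
    have "w \<in> A" if "w \<in> ball z \<delta>" for w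
    proof -
      have "cmod ((poly f ^^ n) w) \<le> 1 + 2 * R" for n
        using chordal_dist_bound[OF _ _ \<delta>(2)[of w n]] that z R(1)
        by (auto simp: A_def dist_commute less_imp_le)
      then show ?thesis
        unfolding A_def using bounded_orbit_in_disc[OF R] by blast
    qed
    with \<delta>(1) show ?thesis
      by blast
  qed
  then have op: "openin (top_of_set (ball 0 1)) (ball 0 1 \<inter> A)"
    unfolding openin_contains_ball by (metis inf.cobounded1 inf.commute inf_mono order_refl)
  obtain M where "\<And>n. cmod ((poly f ^^ n) 0) \<le> M"
    using finite_imp_bounded[OF preperiodic_orbit_finite[OF pre]] unfolding bounded_iff by auto
  then have "0 \<in> A"
    unfolding A_def using bounded_orbit_in_disc[OF R] by blast
  then have "ball 0 1 \<inter> A = ball 0 1"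
    using connected_clopen[of "ball (0::complex) 1"] connected_ball[of "0::complex" 1] op clo
    by (metis Int_iff centre_in_ball empty_iff zero_less_one)
  then show ?thesis
    unfolding A_def by (intro exI[of _ R]) auto
qed

section \<open>Coefficients of the iterates\<close>

lemma coeff_le_of_bounded_on_unit_disc:
  fixes p :: "complex poly"
  assumes "\<And>z. cmod z < 1 \<Longrightarrow> cmod (poly p z) \<le> R"
  shows "cmod (coeff p k) \<le> R"
proof -
  \<comment> \<open>Cauchy's inequality is applied on the unit circle itself, where the bound holds
    by continuity.\<close>
  have bd: "cmod (poly p z) \<le> R" if "cmod z = 1" for z
  proof (rule continuous_on_closure_norm_le[where f = "poly p" and s = "ball 0 1"])
    show "continuous_on (closure (ball 0 1)) (poly p)"
      by (intro continuous_intros)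
    show "\<forall>y\<in>ball 0 1. cmod (poly p y) \<le> R"
      using assms by auto
    show "z \<in> closure (ball 0 1)"
      using that by simp
  qed
  have "(deriv ^^ k) (poly p) = poly ((pderiv ^^ k) p)"
  proof (induction k)
    case (Suc k)
    have "deriv (poly q) = poly (pderiv q)" for q :: "complex poly"
      by (intro ext DERIV_imp_deriv poly_DERIV)
    then show ?case
      by (simp add: Suc)
  qed simp
  then have "(deriv ^^ k) (poly p) 0 = fact k * coeff p k"
    by (simp add: poly_0_coeff_0 coeff_higher_pderiv pochhammer_fact)
  moreover have "cmod ((deriv ^^ k) (poly p) 0) \<le> fact k * R / 1 ^ k"
    using bd by (intro Cauchy_inequality) (auto intro!: continuous_intros holomorphic_intros)
  ultimately show ?thesis
    by (simp add: norm_mult)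
qed

text \<open>
  Applied to reflected polynomials: \<open>r \<equiv> 1 + c x\<^sup>m\<close> modulo \<open>x\<^bsup>m+1\<^esup>\<close>. Reflection makes the top
  coefficients multiplicative without any bookkeeping of degrees.
\<close>

definition two_term :: "nat \<Rightarrow> 'a :: comm_ring_1 \<Rightarrow> 'a poly \<Rightarrow> bool" where
  "two_term m c r \<longleftrightarrow> (\<forall>k\<le>m. coeff r k = coeff (1 + monom c m) k)"

text \<open>With \<open>r = 1 + R\<close> and \<open>s = 1 + S\<close>, both \<open>R\<close> and
  \<open>S\<close> start at \<open>x^m\<close>, so \<open>R * S\<close> starts at
  \<open>x^(2m)\<close>, beyond \<open>x^m\<close> because \<open>m > 0\<close>.\<close>

lemma two_term_mult:
  assumes "m > 0" and "two_term m c r" and "two_term m e s"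
  shows "two_term m (c + e) (r * s)"
proof -
  define R S where "R = r - 1" and "S = s - 1"
  have RS: "coeff R k = coeff (monom c m) k" "coeff S k = coeff (monom e m) k" if "k \<le> m" for k
    using assms(2,3) that by (auto simp: R_def S_def two_term_def)
  have "coeff (R * S) k = 0" if "k \<le> m" for k
    unfolding coeff_mult
  proof (rule sum.neutral, rule ballI)
    fix i assume "i \<in> {..k}"
    then show "coeff R i * coeff S (k - i) = 0"
      using RS(1)[of i] RS(2)[of "k - i"] that assms(1) by (cases "i = m") auto
  qed
  moreover have "r * s = 1 + R + S + R * S"
    by (simp add: R_def S_def algebra_simps)
  ultimately show ?thesis
    unfolding two_term_def by (simp add: RS)
qed

lemma two_term_power:
  assumes "m > 0" and "two_term m c r"
  shows "two_term m (of_nat k * c) (r ^ k)"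
proof (induction k)
  case 0
  then show ?case by (simp add: two_term_def)
next
  case (Suc k)
  from two_term_mult[OF assms Suc] show ?case
    by (simp add: algebra_simps)
qed

text \<open>Below \<open>p^d\<close>, only powers \<open>p^i\<close> with
  \<open>i \<le> d - m\<close> enter \<open>f(p)\<close>. Their degree is at most
  \<open>d * N - m * N < d * N - m\<close>, so the top \<open>m + 1\<close> coefficients are those
  of \<open>p^d\<close>.\<close>

lemma reflect_poly_pcompose_two_term:
  fixes f p :: "'a :: idom poly"
  assumes f: "degree f = d" "lead_coeff f = 1" "\<And>i. d - m < i \<Longrightarrow> i < d \<Longrightarrow> coeff f i = 0"
    and m: "0 < m" "m \<le> d"
    and p: "degree p \<ge> 2" "two_term m c (reflect_poly p)"
  shows "two_term m (of_nat d * c) (reflect_poly (pcompose f p))"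
proof -
  define N where "N = degree p"
  have p0: "p \<noteq> 0"
    using p(1) by auto
  have dpow: "degree (p ^ i) = i * N" for i
    using p0 by (simp add: degree_power_eq N_def)
  \<comment> \<open>This strict inequality is where degree at least 2 of \<open>p\<close>
    matters.\<close>
  have mN: "m < m * N"
    using m(1) p(1) by (simp add: N_def)
  have "coeff (reflect_poly (pcompose f p)) k = coeff (reflect_poly (p ^ d)) k" if k: "k \<le> m" for k
  proof -
    have le: "k \<le> d * N"
      using k m(2) p(1) unfolding N_def
      by (metis le_trans le_add1 mult_2 mult.commute mult_le_mono2)
    have "coeff (pcompose f p) (d * N - k) = (\<Sum>i\<le>d. coeff f i * coeff (p ^ i) (d * N - k))"
      by (simp add: pcompose_altdef poly_altdef coeff_sum degree_map_poly coeff_map_poly f(1))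
    also have "\<dots> = (\<Sum>i\<in>{d}. coeff f i * coeff (p ^ i) (d * N - k))"
    proof (rule sum.mono_neutral_right)
      show "\<forall>i\<in>{..d} - {d}. coeff f i * coeff (p ^ i) (d * N - k) = 0"
      proof
        fix i assume i: "i \<in> {..d} - {d}"
        show "coeff f i * coeff (p ^ i) (d * N - k) = 0"
        proof (cases "d - m < i")
          case True
          then show ?thesis using f(3) i by simp
        next
          case False
          then have "i * N \<le> (d - m) * N"
            by simp
          also have "\<dots> = d * N - m * N"
            by (simp add: diff_mult_distrib)
          also have "\<dots> < d * N - k"
            using mN k m(2) p(1) mult_le_mono1[OF m(2), of N] by linarith
          finally show ?thesis
            using dpow by (simp add: coeff_eq_0)
        qed
      qed
    qed auto
    finally show ?thesis
      using le f(1,2) dpow by (simp add: coeff_reflect_poly degree_pcompose N_def)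
  qed
  then show ?thesis
    using two_term_power[OF m(1) p(2), of d] by (simp add: two_term_def reflect_poly_power)
qed

lemma monic_poly_eq_monom:
  fixes f :: "complex poly"
  assumes deg: "degree f = d" "d \<ge> 2" and lead: "lead_coeff f = 1"
    and bd: "\<And>n z. cmod z < 1 \<Longrightarrow> cmod ((poly f ^^ n) z) \<le> R"
  shows "f = monom 1 d"
proof (rule ccontr)
  assume neq: "f \<noteq> monom 1 d"
  define J where "J = {j. j < d \<and> coeff f j \<noteq> 0}"
  have "J \<noteq> {}"
  proof
    assume "J = {}"
    then have "coeff f i = coeff (monom 1 d) i" for i
      using lead deg(1) coeff_eq_0[of f i] by (cases i d rule: linorder_cases) (auto simp: J_def)
    then show False
      using neq by (simp add: poly_eq_iff)
  qed
  have fin: "finite J"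
    by (simp add: J_def)
  define j a m where "j = Max J" and "a = coeff f j" and "m = d - j"
  have "j \<in> J"
    using fin \<open>J \<noteq> {}\<close> by (simp add: j_def)
  then have j: "j < d" "a \<noteq> 0"
    by (auto simp: J_def a_def)
  have gap: "coeff f i = 0" if "j < i" "i < d" for i
    using Max_ge[OF fin, of i] that unfolding j_def by (metis (mono_tags, lifting) J_def leD mem_Collect_eq)
  have m: "0 < m" "m \<le> d" "d - m = j"
    using j by (auto simp: m_def)
  \<comment> \<open>\<open>P n\<close> is the iterate number \<open>n + 1\<close>, so
    \<open>P 0 = f\<close> already has degree at least 2 and coefficient \<open>a\<close>.\<close>
  define P where "P = (\<lambda>n. (pcompose f ^^ n) f)"
  have P: "degree (P n) \<ge> 2 \<and> two_term m (of_nat d ^ n * a) (reflect_poly (P n))" for n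
  proof (induction n)
    case 0
    have "coeff (reflect_poly f) k = coeff (1 + monom a m) k" if "k \<le> m" for k
      using that m j lead deg gap[of "d - k"]
      by (cases "k = 0"; cases "k = m") (auto simp: coeff_reflect_poly a_def)
    then show ?case
      using deg by (simp add: P_def two_term_def)
  next
    case (Suc n)
    have "degree (P (Suc n)) = d * degree (P n)"
      using deg by (simp add: P_def degree_pcompose)
    moreover have "1 * 2 \<le> d * degree (P n)"
      using Suc deg(2) by (intro mult_le_mono) auto
    ultimately show ?case
      using reflect_poly_pcompose_two_term[OF deg(1) lead _ m(1,2), of "P n"] gap Suc m(3)
      by (simp add: P_def mult.assoc)
  qed
  have "poly (P n) = poly f ^^ Suc n" for n
    by (induction n) (auto simp: P_def poly_pcompose fun_eq_iff)
  then have coeff_bd: "cmod (coeff (P n) k) \<le> R" for n k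
    using bd by (intro coeff_le_of_bounded_on_unit_disc) metis
  have large: "real d ^ n * cmod a \<le> R" for n
  proof -
    have "coeff (reflect_poly (P n)) m = of_nat d ^ n * a"
      using P[of n] m(1) by (auto simp: two_term_def)
    \<comment> \<open>Coefficients of the reflection beyond the degree are 0, a case covered by
      \<open>R \<ge> 0\<close>.\<close>
    then have "of_nat d ^ n * a = (if degree (P n) < m then 0 else coeff (P n) (degree (P n) - m))"
      by (simp add: coeff_reflect_poly)
    moreover have "R \<ge> 0"
      using coeff_bd[of 0 0] norm_ge_zero order_trans by blast
    ultimately have "cmod (of_nat d ^ n * a) \<le> R"
      using coeff_bd by simp
    then show ?thesis
      by (simp add: norm_mult norm_power)
  qed
  obtain n where "R / cmod a < real d ^ n"
    using real_arch_pow[of "real d" "R / cmod a"] deg(2) by auto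
  then show False
    using large[of n] j(2) by (simp add: field_simps)
qed

section \<open>Transfer between the number field and the complex plane\<close>

theorem theorem1p5:
  fixes \<phi> :: "'k :: field_char_0 poly" and d :: nat
  assumes "number_field TYPE('k)"
    and "degree \<phi> = d" and "d \<ge> 2" and "lead_coeff \<phi> = 1"
    and "\<forall>i. coeff \<phi> i \<in> ring_of_integers"
    and "preperiodic (poly \<phi>) 0"
    and "\<forall>\<nu>\<in>archimedean_places. \<forall>\<sigma>. embedding_at \<nu> \<sigma> \<longrightarrow>
           julia_set (poly (map_poly \<sigma> \<phi>)) \<inter> {z. cmod z < 1} = {}"
  shows "\<phi> = monom 1 d"
proof -
  obtain \<sigma> :: "'k \<Rightarrow> complex" where \<sigma>: "field_embedding \<sigma>"
    using number_field_embedding_exists[OF assms(1)] by blast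
  \<comment> \<open>Every complex embedding belongs to some archimedean place, so the Julia set
    hypothesis applies to \<open>\<sigma>\<close>.\<close>
  then have J: "julia_set (poly (map_poly \<sigma> \<phi>)) \<inter> {z. cmod z < 1} = {}"
    using ex_archimedean_place[OF \<sigma>] assms(7) by blast
  have add: "\<sigma> (x + y) = \<sigma> x + \<sigma> y" and mult: "\<sigma> (x * y) = \<sigma> x * \<sigma> y" and one: "\<sigma> 1 = 1" for x y
    using \<sigma> by (auto simp: field_embedding_def)
  have zero: "\<sigma> 0 = 0"
    using add[of 0 0] by simp
  have inj0: "x = 0" if "\<sigma> x = 0" for x
    using mult[of x "inverse x"] that one by (cases "x = 0") auto
  have inj: "x = y" if "\<sigma> x = \<sigma> y" for x y
    using add[of "x - y" y] that inj0[of "x - y"] by simp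
  define f where "f = map_poly \<sigma> \<phi>"
  have cf: "coeff f i = \<sigma> (coeff \<phi> i)" for i
    unfolding f_def by (simp add: coeff_map_poly zero)
  have deg: "degree f = d"
    unfolding f_def using assms(2) inj0 zero by (intro trans[OF degree_map_poly]) auto
  have lead: "lead_coeff f = 1"
    using assms(2,4) one by (simp add: deg cf)
  \<comment> \<open>\<open>\<sigma>\<close> intertwines \<open>\<phi>\<close> with \<open>f\<close>
    and fixes 0, so it carries the orbit of 0 to the orbit of 0.\<close>
  have "poly (map_poly \<sigma> p) (\<sigma> x) = \<sigma> (poly p x)" for p x
    by (induction p) (simp_all add: map_poly_pCons zero add mult)
  then have iter: "(poly f ^^ n) 0 = \<sigma> ((poly \<phi> ^^ n) 0)" for n
    by (induction n) (simp_all add: f_def zero)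
  then have "preperiodic (poly f) 0"
    using assms(6) unfolding preperiodic_def by metis
  then obtain R where "\<And>n z. cmod z < 1 \<Longrightarrow> cmod ((poly f ^^ n) z) \<le> R"
    using iterates_bounded_on_unit_disc[of f] J deg assms(3) unfolding f_def by blast
  then have f: "f = monom 1 d"
    by (rule monic_poly_eq_monom[OF deg assms(3) lead])
  \<comment> \<open>Injectivity of \<open>\<sigma>\<close> pulls the equality of coefficients back
    to the number field.\<close>
  have "coeff \<phi> i = coeff (monom 1 d) i" for i
    using cf[of i] one zero by (intro inj) (auto simp: f)
  then show ?thesis
    by (simp add: poly_eq_iff)
qed

end
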